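(* Let $k \ge 2$ and $n \ge k+1$ be integers and let $\pi \in S_n$ be a permutation of $[n]$. If $\mathcal{A}\subset 2^{[n]}$ is a family of sets that is both induced $Y_k$-free and induced $Y_k'$-free, then $\left|\mathcal{I}(n)^\pi \cap \mathcal{A}\right| \le kn$.
   Context: Let $[n]=\{1,2,\dots,n\}$ and let $2^{[n]}$ denote the power set of $[n]$. A poset $P$ is an induced subposet of a poset $Q$ if there exists an injection $\phi:P\to Q$ such that $x<y$ in $P$ if and only if $\phi(x)<\phi(y)$ in $Q$. A family $\mathcal{A}\subset 2^{[n]}$ is regarded as a poset under set containment, and $\mathcal{A}$ is called induced $P$-free if $P$ is not an induced subposet of $\mathcal{A}$. $Y_k$ denotes the poset on $k+2$ elements $x_1,x_2,\dots,x_k,y,z$ whose relations are generated by $x_1<x_2<\dots<x_k$, $x_k<y$, $x_k<z$ (so $y$ and $z$ are incomparable). $Y_k'$ denotes the same poset with all relations reversed. $\mathcal{I}(n)$ denotes the collection of subsets of $[n]$, excluding $\varnothing$ and $[n]$, which form intervals when the numbers $1,2,\dots,n$ are arranged in order around a circle; that is, the sets $\{i,i+1,\dots,i+t\}$ with $i\in[n]$ and $0\le t\le n-2$, additions taken modulo $n$ (e.g. $\{2,3,4\}$ or $\{n-1,n,1,2\}$). For $\pi\in S_n$, $\mathcal{I}(n)^\pi=\{\{\pi(a_1),\pi(a_2),\dots,\pi(a_r)\} : \{a_1,a_2,\dots,a_r\}\in\mathcal{I}(n)\}$. *)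

theory Defs
  imports Main "HOL-Combinatorics.Permutations"
begin

text \<open>A poset is given by its carrier together with its strict order relation, as a set of
  pairs.\<close>

definition induced_subposet :: "'a set \<Rightarrow> 'a rel \<Rightarrow> 'b set \<Rightarrow> 'b rel \<Rightarrow> bool" where
  "induced_subposet P ltP Q ltQ \<longleftrightarrow>
     (\<exists>\<phi>. inj_on \<phi> P \<and> \<phi> ` P \<subseteq> Q \<and>
        (\<forall>x\<in>P. \<forall>y\<in>P. (x, y) \<in> ltP \<longleftrightarrow> (\<phi> x, \<phi> y) \<in> ltQ))"

definition induced_free :: "'a set \<Rightarrow> 'a rel \<Rightarrow> 'b set set \<Rightarrow> bool" where
  "induced_free P ltP \<A> \<longleftrightarrow> \<not> induced_subposet P ltP \<A> {(A, B). A \<subset> B}"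

datatype Y_elem = Stem nat | Top_y | Top_z

definition Y_carrier :: "nat \<Rightarrow> Y_elem set" where
  "Y_carrier k = Stem ` {1..k} \<union> {Top_y, Top_z}"

definition Y_generators :: "nat \<Rightarrow> Y_elem rel" where
  "Y_generators k =
     {(Stem i, Stem (i + 1)) | i. 1 \<le> i \<and> i < k} \<union> {(Stem k, Top_y), (Stem k, Top_z)}"

definition Y_less :: "nat \<Rightarrow> Y_elem rel" where
  "Y_less k = (Y_generators k)\<^sup>+"

definition induced_Y_free :: "nat \<Rightarrow> nat set set \<Rightarrow> bool" where
  "induced_Y_free k \<A> \<longleftrightarrow> induced_free (Y_carrier k) (Y_less k) \<A>"

definition induced_Y'_free :: "nat \<Rightarrow> nat set set \<Rightarrow> bool" where
  "induced_Y'_free k \<A> \<longleftrightarrow> induced_free (Y_carrier k) ((Y_less k)\<inverse>) \<A>"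

text \<open>The set $\{i, i+1, \dots, i+t\}$ with addition modulo $n$, where residues are represented in
  $\{1,\dots,n\}$ rather than $\{0,\dots,n-1\}$; intended for $1 \le i \le n$.\<close>

definition cyclic_interval :: "nat \<Rightarrow> nat \<Rightarrow> nat \<Rightarrow> nat set" where
  "cyclic_interval n i t = (\<lambda>s. (i + s - 1) mod n + 1) ` {0..t}"

text \<open>The bound $t \le n - 2$ is written without truncated subtraction.\<close>

definition cyclic_intervals :: "nat \<Rightarrow> nat set set" where
  "cyclic_intervals n = {cyclic_interval n i t | i t. i \<in> {1..n} \<and> t + 2 \<le> n}"

definition permuted_intervals :: "nat \<Rightarrow> (nat \<Rightarrow> nat) \<Rightarrow> nat set set" where
  "permuted_intervals n \<pi> = {\<pi> ` S | S. S \<in> cyclic_intervals n}"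

end

theory Submission
  imports Defs
begin

text \<open>
  Let \<open>X\<close> be the family of arcs in question, ordered by proper inclusion. For an arc \<open>x\<close> let its
  height \<open>h x\<close> and its depth \<open>d x\<close> be the largest sizes of chains in \<open>X\<close> with top \<open>x\<close> and with
  bottom \<open>x\<close>. The bound follows by adding the dual inequalities
  \<open>|{h < k}| + |{d \<ge> k}| \<le> kn\<close> and \<open>|{d < k}| + |{h \<ge> k}| \<le> kn\<close>,
  whose left-hand sides have sum \<open>2 |X|\<close>.

  For the first one (lemma \<open>card_low_height_plus_high_depth_le\<close>), group the arcs once by their first
  point and once by their last point. There are at most \<open>n\<close> groups of either kind, and each group is a
  chain. An antichain therefore has at most \<open>n\<close> elements, which bounds each of the heights
  \<open>2, \<dots>, k - 1\<close> by \<open>n\<close>. It remains to show that the minimal arcs and the arcs of depth at least \<open>k\<close>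
  number at most \<open>2n\<close> together. Let \<open>F\<close> and \<open>G\<close> be the sets of arcs that are smallest among those
  with the same first point and with the same last point; both have at most \<open>n\<close> elements. Minimal
  arcs lie in \<open>F \<inter> G\<close>. If \<open>x\<close> is outside \<open>F \<union> G\<close>, then \<open>X\<close> has an arc \<open>a \<subset> x\<close> with the same first
  point and an arc \<open>c \<subset> x\<close> with the same last point; they are incomparable, since \<open>x\<close> is not the
  whole circle, so a chain of \<open>k\<close> arcs with bottom \<open>x\<close> would give an induced \<open>Y'\<^sub>k\<close>. Hence arcs of depth
  at least \<open>k\<close> lie in \<open>F \<union> G\<close>, and \<open>|F \<inter> G| + |F \<union> G| = |F| + |G| \<le> 2n\<close>.

  The second inequality is the first one for the reversed order, with \<open>Y\<^sub>k\<close> in place of \<open>Y'\<^sub>k\<close>.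
  There, two arcs that extend \<open>x\<close> at opposite ends are incomparable because each of
  them misses at least one point of the circle.
\<close>

section \<open>Counting by height and depth\<close>

lemma relpow_converse:
  fixes r :: "'a rel"
  shows "(r\<inverse>) ^^ m = (r ^^ m)\<inverse>"
proof (induction m)
  case (Suc m)
  have "(r\<inverse>) ^^ Suc m = (r ^^ m)\<inverse> O r\<inverse>" by (simp add: Suc)
  also have "\<dots> = (r O r ^^ m)\<inverse>" by (simp add: converse_relcomp)
  also have "\<dots> = (r ^^ Suc m)\<inverse>" by (simp only: relpow_commute relpow.simps)
  finally show ?case .
qed auto

text \<open>Fibres of \<open>f\<close> are chains, so a subset without comparable pairs inside a fibre is embedded by \<open>f\<close>.
  The hypothesis covers antichains as well as the set of least elements of the fibres.\<close>

lemma card_le_if_no_fibre_pair: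
  assumes "finite I" and "f ` X \<subseteq> I"
    and "\<And>x y. \<lbrakk>x \<in> X; y \<in> X; f x = f y\<rbrakk> \<Longrightarrow> x = y \<or> (x, y) \<in> r \<or> (y, x) \<in> r"
    and "Y \<subseteq> X" and "\<And>x y. \<lbrakk>x \<in> Y; y \<in> Y; (x, y) \<in> r\<rbrakk> \<Longrightarrow> f x \<noteq> f y"
  shows "card Y \<le> card I"
proof (rule card_inj_on_le[of f])
  show "inj_on f Y" using assms(3,4,5) unfolding inj_on_def by (metis subsetD)
  show "f ` Y \<subseteq> I" using assms(2,4) by blast
qed (rule assms(1))

text \<open>The first of the two inequalities, for \<open>k = m + 2\<close>: when \<open>r\<close> is a strict order on
  \<open>X\<close>, an element has height at least \<open>m + 2\<close> if and only if it lies in the range of \<open>r ^^ Suc m\<close>,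
  and depth at least \<open>m + 2\<close> if and only if it lies in the domain. The count is made for an abstract relation so that it can be used again for the
  converse relation.\<close>

lemma card_low_height_plus_high_depth_le:
  assumes fin: "finite X"
    and I: "finite I" "f ` X \<subseteq> I" "g ` X \<subseteq> I"
    and f: "\<And>x y. \<lbrakk>x \<in> X; y \<in> X; f x = f y\<rbrakk> \<Longrightarrow> x = y \<or> (x, y) \<in> r \<or> (y, x) \<in> r"
    and g: "\<And>x y. \<lbrakk>x \<in> X; y \<in> X; g x = g y\<rbrakk> \<Longrightarrow> x = y \<or> (x, y) \<in> r \<or> (y, x) \<in> r"
    and fork: "\<And>x a c. \<lbrakk>x \<in> Domain (r ^^ Suc m); (a, x) \<in> r; f a = f x; (c, x) \<in> r; g c = g x\<rbrakk>
      \<Longrightarrow> False"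
  shows "card (X - Range (r ^^ Suc m)) + card (X \<inter> Domain (r ^^ Suc m)) \<le> (m + 2) * card I"
proof -
  let ?n = "card I"
  define F where "F = {x \<in> X. \<nexists>a. (a, x) \<in> r \<and> f a = f x}"
  define G where "G = {x \<in> X. \<nexists>a. (a, x) \<in> r \<and> g a = g x}"
  \<comment> \<open>\<open>level j\<close> consists of the elements of height \<open>j + 1\<close>.\<close>
  define level where "level j = X \<inter> Range (r ^^ j) - Range (r ^^ Suc j)" for j
  have FG: "finite F" "finite G" using fin by (auto simp: F_def G_def)
  have "card F \<le> ?n"
    by (rule card_le_if_no_fibre_pair[OF I(1,2) f]) (auto simp: F_def)
  moreover have "card G \<le> ?n"
    by (rule card_le_if_no_fibre_pair[OF I(1,3) g]) (auto simp: G_def)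
  moreover have "card (X \<inter> Domain (r ^^ Suc m)) \<le> card (F \<union> G)"
  proof (rule card_mono)
    show "X \<inter> Domain (r ^^ Suc m) \<subseteq> F \<union> G"
      using fork unfolding F_def G_def by blast
  qed (use FG in simp)
  moreover have "card (X - Range r) \<le> card (F \<inter> G)"
    by (rule card_mono) (use FG in \<open>auto simp: F_def G_def\<close>)
  ultimately have two: "card (X - Range r) + card (X \<inter> Domain (r ^^ Suc m)) \<le> 2 * ?n"
    using card_Un_Int[OF FG] by linarith
  have level: "card (level j) \<le> ?n" for j
  proof (rule card_le_if_no_fibre_pair[OF I(1,2) f])
    show "f x \<noteq> f y" if "x \<in> level j" "y \<in> level j" "(x, y) \<in> r" for x y
      using that by (auto simp: level_def)
  qed (auto simp: level_def)
  have "X - Range (r ^^ Suc m) \<subseteq> (X - Range r) \<union> (\<Union>j\<in>{1..m}. level j)"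
  proof
    fix x assume x: "x \<in> X - Range (r ^^ Suc m)"
    define j where "j = (LEAST j. x \<notin> Range (r ^^ Suc j))"
    have j: "x \<notin> Range (r ^^ Suc j)" "j \<le> m"
      using x LeastI[of "\<lambda>j. x \<notin> Range (r ^^ Suc j)" m]
        Least_le[of "\<lambda>j. x \<notin> Range (r ^^ Suc j)" m]
      unfolding j_def by blast+
    show "x \<in> (X - Range r) \<union> (\<Union>j\<in>{1..m}. level j)"
    proof (cases j)
      case 0
      then show ?thesis using x j by simp
    next
      case (Suc i)
      then have "x \<in> Range (r ^^ j)"
        using not_less_Least[of i "\<lambda>j. x \<notin> Range (r ^^ Suc j)"]
        by (simp add: j_def[symmetric] del: relpow.simps)
      then show ?thesis using x j Suc by (auto simp: level_def simp del: relpow.simps)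
    qed
  qed
  then have "card (X - Range (r ^^ Suc m)) \<le> card ((X - Range r) \<union> (\<Union>j\<in>{1..m}. level j))"
    by (rule card_mono[rotated]) (use fin in \<open>auto simp: level_def\<close>)
  also have "\<dots> \<le> card (X - Range r) + card (\<Union>j\<in>{1..m}. level j)"
    by (rule card_Un_le)
  also have "card (\<Union>j\<in>{1..m}. level j) \<le> m * ?n"
    using card_UN_le[of "{1..m}" level] sum_bounded_above[of "{1..m}" "\<lambda>j. card (level j)" ?n] level
    by auto
  finally show ?thesis using two by simp
qed

section \<open>Recognizing the forbidden posets\<close>

lemma Stem_less_Stem:
  assumes "1 \<le> i" "i < j" "j \<le> k"
  shows "(Stem i, Stem j) \<in> Y_less k"
  using assms(2,3)
proof (induction j rule: less_induct)
  case (less j)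
  then obtain j' where j: "j = Suc j'" by (cases j) auto
  have step: "(Stem j', Stem j) \<in> Y_generators k" if "1 \<le> j'"
    using less.prems that by (auto simp: Y_generators_def j)
  show ?case
  proof (cases "i = j'")
    case True
    then show ?thesis using step assms(1) by (auto simp: Y_less_def)
  next
    case False
    then have "(Stem i, Stem j') \<in> Y_less k" using less j by auto
    moreover have "(Stem j', Stem j) \<in> Y_generators k"
      using step assms(1) less.prems j by simp
    ultimately show ?thesis unfolding Y_less_def by (rule trancl_into_trancl)
  qed
qed

lemma Stem_less_Top:
  assumes "1 \<le> i" "i \<le> k"
  shows "(Stem i, Top_y) \<in> Y_less k" "(Stem i, Top_z) \<in> Y_less k"
proof -
  have top: "(Stem k, Top_y) \<in> Y_less k" "(Stem k, Top_z) \<in> Y_less k"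
    by (auto simp: Y_less_def Y_generators_def)
  then show "(Stem i, Top_y) \<in> Y_less k" "(Stem i, Top_z) \<in> Y_less k"
    using Stem_less_Stem[of i k k] assms unfolding Y_less_def
    by (metis le_neq_implies_less order_refl trancl_trans)+
qed

text \<open>A chain of \<open>k\<close> elements of \<open>Q\<close> ending in \<open>x\<close>, with two incomparable elements above \<open>x\<close>, is an
  induced copy of the fork. The order \<open>lt\<close> is arbitrary: inclusion gives \<open>Y\<^sub>k\<close>, and reversed inclusion
  gives \<open>Y'\<^sub>k\<close> by \<open>induced_subposet_converse\<close> below. Only preservation of the order is checked along
  the generators; reflection holds because any two elements of the poset other than the two tops are
  comparable, so an asymmetric image relation leaves no choice.\<close>

lemma induced_Y_if_fork:
  assumes lt: "trans lt" "irrefl lt" and r: "r \<subseteq> lt" "r \<subseteq> Q \<times> Q"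
    and k: "1 \<le> k" and chain: "x \<in> Range (r ^^ (k - 1))"
    and fork: "(x, a) \<in> r" "(x, c) \<in> r"
    and incomp: "a \<noteq> c" "(a, c) \<notin> lt" "(c, a) \<notin> lt"
  shows "induced_subposet (Y_carrier k) (Y_less k) Q lt"
proof -
  obtain s where s: "s (k - 1) = x" "\<And>i. i < k - 1 \<Longrightarrow> (s i, s (Suc i)) \<in> r"
    using chain by (auto simp: Range_iff relpow_fun_conv)
  define \<phi> where "\<phi> e = (case e of Stem i \<Rightarrow> s (i - 1) | Top_y \<Rightarrow> a | Top_z \<Rightarrow> c)" for e
  have gen: "(\<phi> e, \<phi> e') \<in> r" if "(e, e') \<in> Y_generators k" for e e'
  proof -
    have "(s (i - 1), s i) \<in> r" if "1 \<le> i" "i < k" for i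
      using s(2)[of "i - 1"] that by simp
    then show ?thesis
      using that fork s(1) by (auto simp: Y_generators_def \<phi>_def)
  qed
  have pres: "(\<phi> e, \<phi> e') \<in> lt" if "(e, e') \<in> Y_less k" for e e'
    using that unfolding Y_less_def
  proof (induction rule: trancl_induct)
    case (base y) then show ?case using gen r by blast
  next
    case (step y z) then show ?case using gen r lt(1) by (meson subsetD transD)
  qed
  have asym: "(\<phi> e', \<phi> e) \<notin> lt" "\<phi> e \<noteq> \<phi> e'" if "(e, e') \<in> Y_less k" for e e'
    using pres[OF that] lt unfolding irrefl_def by (metis transD)+
  have tri: "e = e' \<or> (e, e') \<in> Y_less k \<or> (e', e) \<in> Y_less k \<or> {e, e'} = {Top_y, Top_z}"
    if carrier: "e \<in> Y_carrier k" "e' \<in> Y_carrier k" for e e'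
  proof (cases "\<exists>i j. e = Stem i \<and> e' = Stem j")
    case True
    then obtain i j where ij: "e = Stem i" "e' = Stem j" "i \<in> {1..k}" "j \<in> {1..k}"
      using carrier unfolding Y_carrier_def by auto
    then show ?thesis
      using Stem_less_Stem[of i j k] Stem_less_Stem[of j i k] by (cases i j rule: linorder_cases) auto
  next
    case False
    then show ?thesis
      using carrier Stem_less_Top unfolding Y_carrier_def by auto
  qed
  have top: "\<phi> Top_y = a" "\<phi> Top_z = c" by (simp_all add: \<phi>_def)
  have "inj_on \<phi> (Y_carrier k)"
    using tri asym incomp(1) top by (smt (verit) doubleton_eq_iff inj_onI)
  moreover have "\<phi> ` Y_carrier k \<subseteq> Q"
  proof -
    have "(\<phi> e, a) \<in> r \<or> (\<exists>e'. (\<phi> e, \<phi> e') \<in> r) \<or> e \<in> {Top_y, Top_z}" if "e \<in> Y_carrier k" for e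
    proof (cases e)
      case (Stem i)
      then have "i = k \<or> (Stem i, Stem (i + 1)) \<in> Y_generators k"
        using that by (auto simp: Y_carrier_def Y_generators_def)
      then show ?thesis
      proof
        assume "i = k"
        then show ?thesis using fork(1) s(1) Stem by (simp add: \<phi>_def)
      next
        assume "(Stem i, Stem (i + 1)) \<in> Y_generators k"
        then show ?thesis using gen Stem by blast
      qed
    qed auto
    then show ?thesis using r(2) fork top by fast
  qed
  moreover have "(e, e') \<in> Y_less k \<longleftrightarrow> (\<phi> e, \<phi> e') \<in> lt"
    if "e \<in> Y_carrier k" "e' \<in> Y_carrier k" for e e'
    using tri[OF that] pres asym incomp(2,3) top lt(2)
    by (auto simp: doubleton_eq_iff irrefl_def)
  ultimately show ?thesis unfolding induced_subposet_def by blast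
qed

lemma induced_subposet_converse:
  "induced_subposet P (ltP\<inverse>) Q ltQ \<longleftrightarrow> induced_subposet P ltP Q (ltQ\<inverse>)"
  unfolding induced_subposet_def by auto

lemma induced_subposet_mono:
  "induced_subposet P ltP Q ltQ \<Longrightarrow> Q \<subseteq> Q' \<Longrightarrow> induced_subposet P ltP Q' ltQ"
  unfolding induced_subposet_def by blast

section \<open>Arcs of a circle\<close>

text \<open>Arcs are handled as images of integer intervals under a map that winds the integers around the
  circle. This removes all case distinctions about wrap-around: two arcs with a common end point are
  images of intervals with a common end point, after a shift by a multiple of \<open>n\<close>.\<close>

locale winding =
  fixes q :: "int \<Rightarrow> 'a" and n :: int
  assumes q_eq_iff: "q z = q w \<longleftrightarrow> n dvd z - w"
begin

definition arc :: "int \<Rightarrow> int \<Rightarrow> 'a set" where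
  "arc a b = q ` {a..b}"

lemma arc_shift:
  assumes "n dvd e"
  shows "arc (a + e) (b + e) = arc a b"
proof -
  have "q (z + e) = q z" for z using assms by (simp add: q_eq_iff)
  moreover have "{a + e..b + e} = (\<lambda>z. z + e) ` {a..b}" by simp
  ultimately show ?thesis unfolding arc_def by (simp only: image_image)
qed

lemma arc_mono: "a' \<le> a \<Longrightarrow> b \<le> b' \<Longrightarrow> arc a b \<subseteq> arc a' b'"
  by (auto simp: arc_def)

lemma in_arcI: "a \<le> z \<Longrightarrow> z \<le> b \<Longrightarrow> q z \<in> arc a b"
  by (simp add: arc_def)

text \<open>The first two conditions say that \<open>z\<close> is at distance less than \<open>n\<close> from every point of the
  interval, so no other representative of \<open>q z\<close> can lie in it.\<close>

lemma not_in_arcI: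
  assumes "b - n < z" "z < a + n" "z \<notin> {a..b}"
  shows "q z \<notin> arc a b"
proof
  assume "q z \<in> arc a b"
  then obtain w where w: "w \<in> {a..b}" "n dvd z - w" by (auto simp: arc_def q_eq_iff)
  then have "\<bar>z - w\<bar> < n" using assms by auto
  with w(2) have "z - w = 0" using dvd_imp_le_int[of "z - w" n] by linarith
  then show False using w(1) assms(3) by simp
qed

text \<open>Each of the two subarcs misses the end point of the large arc that the other one contains.\<close>

lemma subarcs_incomparable:
  assumes "b - a < n - 1" "arc a b1 \<subset> arc a b" "arc a1 b \<subset> arc a b"
    and "a \<le> b1" "a1 \<le> b"
  shows "\<not> arc a b1 \<subseteq> arc a1 b" "\<not> arc a1 b \<subseteq> arc a b1"
proof -
  have "b1 < b" "a < a1"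
    using assms(2,3) arc_mono[of a a b b1] arc_mono[of a1 a b b] by force+
  then have "q a \<in> arc a b1" "q a \<notin> arc a1 b" "q b \<in> arc a1 b" "q b \<notin> arc a b1"
    using assms in_arcI[of a a b1] in_arcI[of a1 b b] not_in_arcI[of b a a1] not_in_arcI[of b1 b a]
    by simp_all
  then show "\<not> arc a b1 \<subseteq> arc a1 b" "\<not> arc a1 b \<subseteq> arc a b1" by blast+
qed

text \<open>Each of the two superarcs contains a neighbour of the small arc that the other one misses:
  by the length bounds, neither superarc goes far enough around the circle to reach the neighbour on
  the other side.\<close>

lemma superarcs_incomparable:
  assumes "a \<le> b" "arc a b \<subset> arc a b1" "arc a b \<subset> arc a1 b"
    and "b1 - a < n - 1" "b - a1 < n - 1"
  shows "\<not> arc a b1 \<subseteq> arc a1 b" "\<not> arc a1 b \<subseteq> arc a b1"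
proof -
  have "b < b1" "a1 < a"
    using assms(2,3) arc_mono[of a a b1 b] arc_mono[of a a1 b b] by force+
  then have "q (b + 1) \<in> arc a b1" "q (b + 1) \<notin> arc a1 b"
    "q (a - 1) \<in> arc a1 b" "q (a - 1) \<notin> arc a b1"
    using assms in_arcI[of a "b + 1" b1] in_arcI[of a1 "a - 1" b]
      not_in_arcI[of b "b + 1" a1] not_in_arcI[of b1 "a - 1" a]
    by simp_all
  then show "\<not> arc a b1 \<subseteq> arc a1 b" "\<not> arc a1 b \<subseteq> arc a b1" by blast+
qed

end

lemma cyclic_interval_eq_image:
  assumes "i \<ge> 1"
  shows "cyclic_interval n i t =
    (\<lambda>z. nat (z mod int n) + 1) ` {int i - 1..int i - 1 + int t}"
proof -
  have "{int i - 1..int i - 1 + int t} = (+) (int i - 1) ` int ` {0..t}"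
    unfolding image_int_atLeastAtMost image_add_atLeastAtMost by simp
  moreover have "(i + s - 1) mod n + 1 = nat ((int i - 1 + int s) mod int n) + 1" for s
  proof -
    have "int i - 1 + int s = int (i + s - 1)" using assms by linarith
    then show ?thesis using zmod_int[of "i + s - 1" n] nat_int by metis
  qed
  ultimately show ?thesis
    unfolding cyclic_interval_def by (simp only: image_image)
qed

section \<open>The bound\<close>

theorem theorem3:
  fixes k n :: nat and \<pi> :: "nat \<Rightarrow> nat" and \<A> :: "nat set set"
  assumes "k \<ge> 2" and "n \<ge> k + 1"
    and "\<pi> permutes {1..n}"
    and "\<A> \<subseteq> Pow {1..n}"
    and "induced_Y_free k \<A>" and "induced_Y'_free k \<A>"
  shows "card (permuted_intervals n \<pi> \<inter> \<A>) \<le> k * n"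
proof -
  define X where "X = permuted_intervals n \<pi> \<inter> \<A>"
  define q where "q z = \<pi> (nat (z mod int n) + 1)" for z
  interpret winding q "int n"
  proof
    fix z w
    have "q z = q w \<longleftrightarrow> nat (z mod int n) = nat (w mod int n)"
      unfolding q_def inj_eq[OF permutes_inj[OF assms(3)]] by simp
    also have "\<dots> \<longleftrightarrow> z mod int n = w mod int n"
      by (rule eq_nat_nat_iff) (use assms(1,2) in auto)
    finally show "q z = q w \<longleftrightarrow> int n dvd z - w" by (simp add: mod_eq_dvd_iff)
  qed
  have "\<exists>a b. S = arc a b \<and> a \<le> b \<and> b - a < int n - 1" if "S \<in> X" for S
  proof -
    obtain i t where it: "S = \<pi> ` cyclic_interval n i t" "1 \<le> i" "t + 2 \<le> n"
      using \<open>S \<in> X\<close> by (auto simp: X_def permuted_intervals_def cyclic_intervals_def)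
    have "S = arc (int i - 1) (int i - 1 + int t)"
      using it assms(1,2) unfolding arc_def
      by (simp add: cyclic_interval_eq_image q_def image_image)
    then show ?thesis using it(3) by force
  qed
  then obtain start stop where
    arc: "\<And>S. S \<in> X \<Longrightarrow> S = arc (start S) (stop S)"
    and le: "\<And>S. S \<in> X \<Longrightarrow> start S \<le> stop S"
    and short: "\<And>S. S \<in> X \<Longrightarrow> stop S - start S < int n - 1"
    by metis
  \<comment> \<open>The first and the last point of an arc, as points of the circle.\<close>
  define f where "f S = q (start S)" for S
  define g where "g S = q (stop S)" for S
  have same_start: "\<exists>b. S = arc (start T) b \<and> start T \<le> b \<and> b - start T < int n - 1"
    if "S \<in> X" "T \<in> X" "f S = f T" for S T
    using arc_shift[of "start T - start S" "start S" "stop S"] arc le short that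
    by (intro exI[of _ "stop S + (start T - start S)"]) (auto simp: f_def q_eq_iff dvd_diff_commute)
  have same_stop: "\<exists>a. S = arc a (stop T) \<and> a \<le> stop T \<and> stop T - a < int n - 1"
    if "S \<in> X" "T \<in> X" "g S = g T" for S T
    using arc_shift[of "stop T - stop S" "start S" "stop S"] arc le short that
    by (intro exI[of _ "start S + (stop T - stop S)"]) (auto simp: g_def q_eq_iff dvd_diff_commute)
  define lt where "lt = {(A, B :: nat set). A \<subset> B}"
  define r where "r = lt \<inter> X \<times> X"
  have lt: "trans lt" "irrefl lt" "trans (lt\<inverse>)" "irrefl (lt\<inverse>)"
    by (auto simp: lt_def trans_def irrefl_def)
  have r: "r \<subseteq> lt" "r\<inverse> \<subseteq> lt\<inverse>" "r \<subseteq> X \<times> X" "r\<inverse> \<subseteq> X \<times> X" by (auto simp: r_def)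
  have fin: "finite X"
    using assms(4) by (auto simp: X_def intro: finite_subset)
  have range: "f ` X \<subseteq> {1..n}" "g ` X \<subseteq> {1..n}"
  proof -
    have "q z \<in> {1..n}" for z
    proof -
      have "0 \<le> z mod int n" "z mod int n < int n" using assms(1,2) by auto
      then show ?thesis unfolding q_def permutes_in_image[OF assms(3)] by simp
    qed
    then show "f ` X \<subseteq> {1..n}" "g ` X \<subseteq> {1..n}" by (auto simp: f_def g_def)
  qed
  have f: "S = T \<or> (S, T) \<in> r \<or> (T, S) \<in> r" if ST: "S \<in> X" "T \<in> X" "f S = f T" for S T
  proof -
    obtain b where "S = arc (start T) b" using same_start[OF ST] by blast
    then have "S \<subseteq> T \<or> T \<subseteq> S"
      using arc[OF ST(2)] arc_mono[of "start T" "start T"] by (metis linear order_refl)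
    then show ?thesis using ST by (auto simp: r_def lt_def)
  qed
  have g: "S = T \<or> (S, T) \<in> r \<or> (T, S) \<in> r" if ST: "S \<in> X" "T \<in> X" "g S = g T" for S T
  proof -
    obtain a where "S = arc a (stop T)" using same_stop[OF ST] by blast
    then have "S \<subseteq> T \<or> T \<subseteq> S"
      using arc[OF ST(2)] arc_mono[of _ _ "stop T" "stop T"] by (metis linear order_refl)
    then show ?thesis using ST by (auto simp: r_def lt_def)
  qed
  define m where "m = k - 2"
  have m: "k - 1 = Suc m" "k = m + 2" using assms(1) by (auto simp: m_def)
  have no_Y: "\<not> induced_subposet (Y_carrier k) (Y_less k) X lt"
    using assms(5) induced_subposet_mono[of _ _ X]
    unfolding induced_Y_free_def induced_free_def lt_def X_def by blast
  have no_Y': "\<not> induced_subposet (Y_carrier k) (Y_less k) X (lt\<inverse>)"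
    using assms(6) induced_subposet_mono[of _ _ X]
    unfolding induced_Y'_free_def induced_free_def lt_def X_def
    by (metis induced_subposet_converse inf_le2)
  \<comment> \<open>Subarcs: depth at least \<open>k\<close> together with a fork below gives \<open>Y'\<^sub>k\<close>.\<close>
  have "card (X - Range (r ^^ Suc m)) + card (X \<inter> Domain (r ^^ Suc m)) \<le> (m + 2) * card {1..n}"
  proof (rule card_low_height_plus_high_depth_le[OF fin _ range f g])
    fix x a c
    assume x: "x \<in> Domain (r ^^ Suc m)" and a: "(a, x) \<in> r" "f a = f x"
      and c: "(c, x) \<in> r" "g c = g x"
    have X: "x \<in> X" "a \<in> X" "c \<in> X" using a c r(3) by auto
    obtain b' where b': "a = arc (start x) b'" "start x \<le> b'"
      using same_start X a by metis
    obtain a' where a': "c = arc a' (stop x)" "a' \<le> stop x"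
      using same_stop X c by metis
    have sub: "a \<subset> x" "c \<subset> x" using a c by (auto simp: r_def lt_def)
    have "\<not> a \<subseteq> c" "\<not> c \<subseteq> a"
      using subarcs_incomparable[of "stop x" "start x" b' a']
        sub arc[OF X(1)] b' a' short[OF X(1)] by simp_all
    then have "a \<noteq> c" "(a, c) \<notin> lt\<inverse>" "(c, a) \<notin> lt\<inverse>" by (auto simp: lt_def)
    moreover have "x \<in> Range ((r\<inverse>) ^^ (k - 1))"
      using x unfolding m(1) relpow_converse by simp
    moreover have "(x, a) \<in> r\<inverse>" "(x, c) \<in> r\<inverse>" using a c by simp_all
    ultimately show False
      using no_Y' induced_Y_if_fork[OF lt(3,4) r(2,4)] assms(1) by simp
  qed auto
  \<comment> \<open>Superarcs: height at least \<open>k\<close> together with a fork above gives \<open>Y\<^sub>k\<close>.\<close>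
  moreover
  have "card (X - Range ((r\<inverse>) ^^ Suc m)) + card (X \<inter> Domain ((r\<inverse>) ^^ Suc m)) \<le> (m + 2) * card {1..n}"
  proof (rule card_low_height_plus_high_depth_le[OF fin _ range])
    fix x a c
    assume x: "x \<in> Domain ((r\<inverse>) ^^ Suc m)" and a: "(a, x) \<in> r\<inverse>" "f a = f x"
      and c: "(c, x) \<in> r\<inverse>" "g c = g x"
    have X: "x \<in> X" "a \<in> X" "c \<in> X" using a c r(3) by auto
    obtain b' where b': "a = arc (start x) b'" "b' - start x < int n - 1"
      using same_start X a by metis
    obtain a' where a': "c = arc a' (stop x)" "stop x - a' < int n - 1"
      using same_stop X c by metis
    have sup: "x \<subset> a" "x \<subset> c" using a c by (auto simp: r_def lt_def)
    have "\<not> a \<subseteq> c" "\<not> c \<subseteq> a"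
      using superarcs_incomparable[of "start x" "stop x" b' a']
        sup arc[OF X(1)] b' a' le[OF X(1)] by simp_all
    then have "a \<noteq> c" "(a, c) \<notin> lt" "(c, a) \<notin> lt" by (auto simp: lt_def)
    moreover have "x \<in> Range (r ^^ (k - 1))"
      using x unfolding m(1) relpow_converse by simp
    moreover have "(x, a) \<in> r" "(x, c) \<in> r" using a c by simp_all
    ultimately show False
      using no_Y induced_Y_if_fork[OF lt(1,2) r(1,3)] assms(1) by simp
  qed (use f g in auto)
  moreover have "card (X - D) + card (X \<inter> D) = card X" for D
    using card_Int_Diff[OF fin, of D] by simp
  note this[of "Range (r ^^ Suc m)"] this[of "Domain (r ^^ Suc m)"]
  ultimately have "2 * card X \<le> 2 * ((m + 2) * n)"
    unfolding relpow_converse Range_converse Domain_converse card_atLeastAtMost diff_Suc_1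
    by linarith
  then show ?thesis using m(2) by (simp add: X_def)
qed

end
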